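(* Let $F$ be a two-dimensional lattice with $F\notin\mathfrak{M}_2:=\{\ell_1^{(2)}\}\cup\{\ell_\infty^{(2)}\}\cup\mathcal{F}_{2,2}\cup\mathcal{F}_{2,3}$. Then $X_1\oplus_F X_2$ is not a Daugavet domain for any Banach spaces $X_1$ and $X_2$.
   Context: All Banach spaces are real and different from $\{0\}$. A nonzero continuous linear operator $G:X\to Y$ between Banach spaces is a Daugavet center if every (bounded) rank-1 operator $T:X\to Y$ satisfies $\|G+T\|=\|G\|+\|T\|$. A Banach space $X$ is a Daugavet domain if there exist a Banach space $Y$ and a Daugavet center $G:X\to Y$. A two-dimensional lattice is a space $F=(\mathbb{R}^2,\|\cdot\|)$, where the norm satisfies $\|(1,0)\|=\|(0,1)\|=1$ and $\|(a_1,a_2)\|=\|(|a_1|,|a_2|)\|$ for all $(a_1,a_2)$, ordered coordinatewise. $\ell_1^{(2)},\ell_\infty^{(2)}$ denote $\mathbb{R}^2$ with the $\ell_1$- and $\ell_\infty$-norm. For Banach spaces $X_1,X_2$, $X_1\oplus_F X_2$ is the space of pairs $(x_1,x_2)$, $x_i\in X_i$, with norm $\|(x_1,x_2)\|=\|(\|x_1\|,\|x_2\|)\|_F$. $S_F^+=\{a\in F:\|a\|=1,\ a\ge 0\}$. We say $S_F^+$ is a polygon with $n$ edges if it is a polygonal arc from $(1,0)$ to $(0,1)$ consisting of exactly $n$ edges (maximal nondegenerate line segments). For such $F$ put $\hat{x}_1=\max\{y:(1,y)\in S_F^+\}$ and $\hat{x}_2=\max\{x:(x,1)\in S_F^+\}$.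 If $S_F^+$ is a polygon with $n$ edges, then $F\in\mathcal{F}_{n-1,n}$ if $\hat{x}_1>0$ and $\hat{x}_2>0$; $F\in\mathcal{F}_{n,n}$ if exactly one of $\hat{x}_1,\hat{x}_2$ equals zero; $F\in\mathcal{F}_{n+1,n}$ if $\hat{x}_1=\hat{x}_2=0$. *)

theory Defs
  imports "HOL-Analysis.Analysis"
begin

section \<open>Norms given as functions\<close>

text \<open>
  The norm of \<open>X\<^sub>1 \<oplus>\<^sub>F X\<^sub>2\<close> depends on the variable norm \<open>F\<close>, so it cannot be a type class
  instance. Norms that vary are therefore functions on a real vector space; spaces that need
  no such dependency are types of class \<^class>\<open>banach\<close>.
\<close>

definition is_norm :: "('a::real_vector \<Rightarrow> real) \<Rightarrow> bool" where
  "is_norm \<nu> \<longleftrightarrow>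
     (\<forall>x. 0 \<le> \<nu> x) \<and> (\<forall>x. \<nu> x = 0 \<longleftrightarrow> x = 0) \<and>
     (\<forall>c x. \<nu> (c *\<^sub>R x) = \<bar>c\<bar> * \<nu> x) \<and> (\<forall>x y. \<nu> (x + y) \<le> \<nu> x + \<nu> y)"

definition complete_norm :: "('a::real_vector \<Rightarrow> real) \<Rightarrow> bool" where
  "complete_norm \<nu> \<longleftrightarrow>
     (\<forall>s :: nat \<Rightarrow> 'a.
        (\<forall>e>0. \<exists>M. \<forall>m\<ge>M. \<forall>n\<ge>M. \<nu> (s m - s n) < e) \<longrightarrow>
        (\<exists>l. (\<lambda>n. \<nu> (s n - l)) \<longlonglongrightarrow> 0))"

definition banach_norm :: "('a::real_vector \<Rightarrow> real) \<Rightarrow> bool" where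
  "banach_norm \<nu> \<longleftrightarrow> is_norm \<nu> \<and> complete_norm \<nu> \<and> (UNIV :: 'a set) \<noteq> {0}"

section \<open>Daugavet centers and Daugavet domains\<close>

definition bounded_operator :: "('x::real_vector \<Rightarrow> real) \<Rightarrow> ('x \<Rightarrow> 'y::real_normed_vector) \<Rightarrow> bool" where
  "bounded_operator \<nu> T \<longleftrightarrow> linear T \<and> (\<exists>K. \<forall>x. norm (T x) \<le> K * \<nu> x)"

text \<open>
  Since \<open>0 / 0 = 0\<close>, the point \<open>x = 0\<close> does not affect the supremum, which is the usual operator
  norm whenever \<open>T\<close> is bounded.
\<close>

definition operator_norm :: "('x::real_vector \<Rightarrow> real) \<Rightarrow> ('x \<Rightarrow> 'y::real_normed_vector) \<Rightarrow> real" where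
  "operator_norm \<nu> T = (SUP x. norm (T x) / \<nu> x)"

lemma operator_norm_norm: "operator_norm norm T = onorm T"
  by (simp add: operator_norm_def onorm_def)

lemma bounded_operator_norm: "bounded_operator norm T \<longleftrightarrow> bounded_linear T"
  by (auto simp: bounded_operator_def bounded_linear_def bounded_linear_axioms_def mult.commute)

definition daugavet_center :: "('x::real_vector \<Rightarrow> real) \<Rightarrow> ('x \<Rightarrow> 'y::banach) \<Rightarrow> bool" where
  "daugavet_center \<nu> G \<longleftrightarrow>
     bounded_operator \<nu> G \<and> (\<exists>x. G x \<noteq> 0) \<and>
     (\<forall>T :: 'x \<Rightarrow> 'y. bounded_operator \<nu> T \<and> dim (range T) = 1 \<longrightarrow>
        operator_norm \<nu> (\<lambda>x. G x + T x) = operator_norm \<nu> G + operator_norm \<nu> T)"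

text \<open>
  HOL has no quantifier over types, so the codomain space is a parameter: \<open>(X, \<nu>)\<close> is a Daugavet
  domain iff \<open>daugavet_domain \<nu> TYPE('y)\<close> holds for some Banach space \<open>'y\<close>, and it is not a
  Daugavet domain iff \<open>\<not> daugavet_domain \<nu> TYPE('y)\<close> holds with \<open>'y\<close> a free type variable.
\<close>

definition daugavet_domain :: "('x::real_vector \<Rightarrow> real) \<Rightarrow> 'y::banach itself \<Rightarrow> bool" where
  "daugavet_domain \<nu> (_ :: 'y itself) \<longleftrightarrow>
     banach_norm \<nu> \<and> (\<exists>G :: 'x \<Rightarrow> 'y. daugavet_center \<nu> G)"

section \<open>Two-dimensional lattices\<close>

definition two_dim_lattice :: "(real \<times> real \<Rightarrow> real) \<Rightarrow> bool" where
  "two_dim_lattice F \<longleftrightarrow>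
     is_norm F \<and> F (1, 0) = 1 \<and> F (0, 1) = 1 \<and> (\<forall>a b. F (a, b) = F (\<bar>a\<bar>, \<bar>b\<bar>))"

definition ell1_2 :: "real \<times> real \<Rightarrow> real" where
  "ell1_2 = (\<lambda>(a, b). \<bar>a\<bar> + \<bar>b\<bar>)"

definition ell_infinity_2 :: "real \<times> real \<Rightarrow> real" where
  "ell_infinity_2 = (\<lambda>(a, b). max \<bar>a\<bar> \<bar>b\<bar>)"

definition F_sum_norm ::
  "(real \<times> real \<Rightarrow> real) \<Rightarrow> 'a::real_normed_vector \<times> 'b::real_normed_vector \<Rightarrow> real" where
  "F_sum_norm F = (\<lambda>(x, y). F (norm x, norm y))"

definition positive_sphere :: "(real \<times> real \<Rightarrow> real) \<Rightarrow> (real \<times> real) set" where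
  "positive_sphere F = {(a, b). F (a, b) = 1 \<and> 0 \<le> a \<and> 0 \<le> b}"

section \<open>Polygonal arcs and the lattice classes\<close>

definition nondegenerate_segment :: "(real \<times> real) set \<Rightarrow> bool" where
  "nondegenerate_segment e \<longleftrightarrow> (\<exists>u v. u \<noteq> v \<and> e = closed_segment u v)"

definition edges :: "(real \<times> real) set \<Rightarrow> (real \<times> real) set set" where
  "edges P = {e. nondegenerate_segment e \<and> e \<subseteq> P \<and>
                 (\<forall>e'. nondegenerate_segment e' \<and> e' \<subseteq> P \<and> e \<subseteq> e' \<longrightarrow> e' = e)}"

definition polygonal_arc_with_edges ::
  "(real \<times> real) set \<Rightarrow> real \<times> real \<Rightarrow> real \<times> real \<Rightarrow> nat \<Rightarrow> bool" where
  "polygonal_arc_with_edges P p q n \<longleftrightarrow>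
     (\<exists>g. arc g \<and> pathstart g = p \<and> pathfinish g = q \<and> path_image g = P) \<and>
     P = \<Union>(edges P) \<and> finite (edges P) \<and> card (edges P) = n"

definition polygon_with_edges :: "(real \<times> real \<Rightarrow> real) \<Rightarrow> nat \<Rightarrow> bool" where
  "polygon_with_edges F n \<longleftrightarrow> polygonal_arc_with_edges (positive_sphere F) (1, 0) (0, 1) n"

text \<open>
  The two maxima exist for every two-dimensional lattice: the sets are compact and contain \<open>0\<close>.
\<close>

definition x_hat1 :: "(real \<times> real \<Rightarrow> real) \<Rightarrow> real" where
  "x_hat1 F = (GREATEST y. (1, y) \<in> positive_sphere F)"

definition x_hat2 :: "(real \<times> real \<Rightarrow> real) \<Rightarrow> real" where
  "x_hat2 F = (GREATEST x. (x, 1) \<in> positive_sphere F)"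

definition calF :: "nat \<Rightarrow> nat \<Rightarrow> (real \<times> real \<Rightarrow> real) set" where
  "calF m n = {F. two_dim_lattice F \<and> polygon_with_edges F n \<and>
     (m + 1 = n \<and> x_hat1 F > 0 \<and> x_hat2 F > 0 \<or>
      m = n \<and> (x_hat1 F = 0) \<noteq> (x_hat2 F = 0) \<or>
      m = n + 1 \<and> x_hat1 F = 0 \<and> x_hat2 F = 0)}"

definition frakM2 :: "(real \<times> real \<Rightarrow> real) set" where
  "frakM2 = {ell1_2} \<union> {ell_infinity_2} \<union> calF 2 2 \<union> calF 2 3"

section \<open>The F-sum of Banach spaces is a Banach space\<close>

text \<open>
  Hence the conjunct \<open>banach_norm \<nu>\<close> in \<open>daugavet_domain \<nu> TYPE('y)\<close> always holds for such sums.
\<close>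

lemma two_dim_lattice_mono:
  assumes "two_dim_lattice F" "0 \<le> a" "a \<le> a'" "0 \<le> b" "b \<le> b'"
  shows "F (a, b) \<le> F (a', b')"
proof -
  have tri: "F (x + y) \<le> F x + F y" and hom: "F (c *\<^sub>R x) = \<bar>c\<bar> * F x" for x y c
    using assms(1) unfolding two_dim_lattice_def is_norm_def by blast+
  have sym: "F (u, v) = F (\<bar>u\<bar>, \<bar>v\<bar>)" for u v
    using assms(1) by (simp add: two_dim_lattice_def)
  have mono1: "F (u, v) \<le> F (u', v)" if "0 \<le> u" "u \<le> u'" for u u' v
  proof (cases "u' = 0")
    case True
    then show ?thesis using that by simp
  next
    case False
    define t where "t = (1 + u / u') / 2"
    have u': "u' > 0" using False that by simp
    have t: "0 \<le> t" "t \<le> 1" using that u' by (auto simp: t_def field_simps)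
    have e: "(u, v) = t *\<^sub>R (u', v) + (1 - t) *\<^sub>R (- u', v)"
      using u' by (auto simp: t_def field_simps)
    have "F (u, v) \<le> F (t *\<^sub>R (u', v)) + F ((1 - t) *\<^sub>R (- u', v))"
      unfolding e by (rule tri)
    also have "\<dots> = t * F (u', v) + (1 - t) * F (- u', v)"
      using t by (simp only: hom abs_of_nonneg diff_ge_0_iff_ge)
    also have "F (- u', v) = F (u', v)" using sym[of "- u'" v] sym[of u' v] by simp
    finally show ?thesis by (simp add: algebra_simps)
  qed
  have mono2: "F (u, v) \<le> F (u, v')" if "0 \<le> v" "v \<le> v'" for u v v'
  proof (cases "v' = 0")
    case True
    then show ?thesis using that by simp
  next
    case False
    define t where "t = (1 + v / v') / 2"
    have v': "v' > 0" using False that by simp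
    have t: "0 \<le> t" "t \<le> 1" using that v' by (auto simp: t_def field_simps)
    have e: "(u, v) = t *\<^sub>R (u, v') + (1 - t) *\<^sub>R (u, - v')"
      using v' by (auto simp: t_def field_simps)
    have "F (u, v) \<le> F (t *\<^sub>R (u, v')) + F ((1 - t) *\<^sub>R (u, - v'))"
      unfolding e by (rule tri)
    also have "\<dots> = t * F (u, v') + (1 - t) * F (u, - v')"
      using t by (simp only: hom abs_of_nonneg diff_ge_0_iff_ge)
    also have "F (u, - v') = F (u, v')" using sym[of u "- v'"] sym[of u v'] by simp
    finally show ?thesis by (simp add: algebra_simps)
  qed
  show ?thesis
    using mono1[of a a' b] mono2[of b b' a'] assms by linarith
qed

lemma F_sum_norm_bounds:
  assumes F: "two_dim_lattice F"
  shows "norm x \<le> F_sum_norm F (x, y)" "norm y \<le> F_sum_norm F (x, y)"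
    "F_sum_norm F (x, y) \<le> norm x + norm y"
proof -
  have tri: "F (u + v) \<le> F u + F v" and hom: "F (c *\<^sub>R u) = \<bar>c\<bar> * F u" for u v c
    using F unfolding two_dim_lattice_def is_norm_def by blast+
  have e: "F (a, 0) = \<bar>a\<bar>" "F (0, a) = \<bar>a\<bar>" for a
    using hom[of a "(1, 0)"] hom[of a "(0, 1)"] F by (simp_all add: two_dim_lattice_def)
  show "norm x \<le> F_sum_norm F (x, y)"
    using two_dim_lattice_mono[OF F, of "norm x" "norm x" 0 "norm y"] e
    by (simp add: F_sum_norm_def)
  show "norm y \<le> F_sum_norm F (x, y)"
    using two_dim_lattice_mono[OF F, of 0 "norm x" "norm y" "norm y"] e
    by (simp add: F_sum_norm_def)
  show "F_sum_norm F (x, y) \<le> norm x + norm y"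
    using tri[of "(norm x, 0)" "(0, norm y)"] e by (simp add: F_sum_norm_def)
qed

lemma banach_norm_F_sum_norm:
  assumes F: "two_dim_lattice F" and "(UNIV :: 'a::banach set) \<noteq> {0}"
  shows "banach_norm (F_sum_norm F :: 'a \<times> 'b::banach \<Rightarrow> real)"
proof -
  let ?n = "F_sum_norm F :: 'a \<times> 'b \<Rightarrow> real"
  have tri: "F (u + v) \<le> F u + F v" and hom: "F (c *\<^sub>R u) = \<bar>c\<bar> * F u"
    and nn: "0 \<le> F u" and z: "F u = 0 \<longleftrightarrow> u = 0" for u v c
    using F unfolding two_dim_lattice_def is_norm_def by blast+
  have "?n (x + y) \<le> ?n x + ?n y" for x y
  proof -
    obtain a b c d where xy: "x = (a, b)" "y = (c, d)" by fastforce
    have "?n (x + y) \<le> F (norm a + norm c, norm b + norm d)"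
      unfolding xy F_sum_norm_def
      by (auto intro!: two_dim_lattice_mono[OF F] norm_triangle_ineq)
    also have "\<dots> \<le> ?n x + ?n y"
      using tri[of "(norm a, norm b)" "(norm c, norm d)"] by (simp add: xy F_sum_norm_def)
    finally show ?thesis .
  qed
  moreover have "?n (c *\<^sub>R x) = \<bar>c\<bar> * ?n x" for c x
    using hom[of "\<bar>c\<bar>" "(norm (fst x), norm (snd x))"]
    by (simp add: F_sum_norm_def split_beta)
  ultimately have "is_norm ?n"
    by (auto simp: is_norm_def F_sum_norm_def nn z zero_prod_def)
  moreover have "complete_norm ?n"
    unfolding complete_norm_def
  proof (intro allI impI)
    fix s :: "nat \<Rightarrow> 'a \<times> 'b"
    assume s: "\<forall>e>0. \<exists>M. \<forall>m\<ge>M. \<forall>n\<ge>M. ?n (s m - s n) < e"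
    have le: "norm (fst x) \<le> ?n x" "norm (snd x) \<le> ?n x"
      "?n x \<le> norm (fst x) + norm (snd x)" for x
      using F_sum_norm_bounds[OF F, of "fst x" "snd x"] F_sum_norm_bounds(2)[OF F, of "snd x" "fst x"]
      by simp_all
    have "Cauchy (\<lambda>n. fst (s n))" "Cauchy (\<lambda>n. snd (s n))"
      unfolding Cauchy_def dist_norm
      using s le(1,2) by (metis fst_diff snd_diff le_less_trans)+
    then obtain a b where ab: "(\<lambda>n. fst (s n)) \<longlonglongrightarrow> a" "(\<lambda>n. snd (s n)) \<longlonglongrightarrow> b"
      using Cauchy_convergent convergent_def by metis
    have "(\<lambda>n. norm (fst (s n) - a) + norm (snd (s n) - b)) \<longlonglongrightarrow> norm (a - a) + norm (b - b)"
      by (intro tendsto_intros ab)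
    then have lim: "(\<lambda>n. norm (fst (s n) - a) + norm (snd (s n) - b)) \<longlonglongrightarrow> 0" by simp
    have "(\<lambda>n. ?n (s n - (a, b))) \<longlonglongrightarrow> 0"
    proof (rule tendsto_sandwich[OF _ _ tendsto_const lim])
      show "\<forall>\<^sub>F n in sequentially. 0 \<le> ?n (s n - (a, b))"
        using le(1) norm_ge_zero order_trans by (blast intro: always_eventually)
      show "\<forall>\<^sub>F n in sequentially. ?n (s n - (a, b)) \<le> norm (fst (s n) - a) + norm (snd (s n) - b)"
        using le(3)[of "s n - (a, b)" for n] by simp
    qed
    then show "\<exists>l. (\<lambda>n. ?n (s n - l)) \<longlonglongrightarrow> 0" by blast
  qed
  moreover have "(UNIV :: ('a \<times> 'b) set) \<noteq> {0}"
  proof -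
    obtain x :: 'a where "x \<noteq> 0" using assms(2) by auto
    then have "(x, 0 :: 'b) \<notin> {0}" by (simp add: zero_prod_def)
    then show ?thesis by blast
  qed
  ultimately show ?thesis by (simp add: banach_norm_def)
qed

end

theory Submission
  imports Defs
begin

text \<open>
  If \<open>G\<close> is a Daugavet center on \<open>X\<^sub>1 \<oplus>\<^sub>F X\<^sub>2\<close> and \<open>y\<close> is a unit vector of its codomain, then every
  slice of the unit ball contains points \<open>x\<close> for which \<open>\<parallel>G x + \<parallel>G\<parallel> y\<parallel>\<close> is almost \<open>2 \<parallel>G\<parallel>\<close>. Take first
  a point \<open>u\<close> in a slice given by a functional on \<open>X\<^sub>1\<close>, and then, for \<open>y = G u / \<parallel>G u\<parallel>\<close>, a point \<open>v\<close>
  in a slice given by a functional on \<open>X\<^sub>2\<close>. The norms of the coordinates of \<open>u\<close> and \<open>v\<close> are close to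
  \<open>(1, t)\<close> and \<open>(s, 1)\<close>, and \<open>\<parallel>u + v\<parallel>\<close> is close to \<open>2\<close>. In the limit the segment from \<open>(1, t)\<close> to
  \<open>(s, 1)\<close> lies in the unit sphere of \<open>F\<close>, so the positive part of the sphere consists of this
  segment, a vertical one and a horizontal one, which is the case exactly for the lattices in
  \<open>\<MM>\<^sub>2\<close>.
\<close>

section \<open>The Hahn-Banach theorem\<close>

text \<open>Homogeneity is an inequality for positive scalars only, which is easy to check for
  infima; applying it to \<open>inverse c\<close> as well turns it into an equality.\<close>

definition sublinear :: "('a::real_vector \<Rightarrow> real) \<Rightarrow> bool" where
  "sublinear q \<longleftrightarrow> (\<forall>x y. q (x + y) \<le> q x + q y) \<and> (\<forall>c>0. \<forall>x. q (c *\<^sub>R x) \<le> c * q x)"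

lemma sublinearI:
  assumes "\<And>x y. q (x + y) \<le> q x + q y" "\<And>c x. c > 0 \<Longrightarrow> q (c *\<^sub>R x) \<le> c * q x"
  shows "sublinear q"
  using assms by (simp add: sublinear_def)

lemma sublinear_add: "sublinear q \<Longrightarrow> q (x + y) \<le> q x + q y"
  by (simp add: sublinear_def)

lemma sublinear_zero:
  assumes "sublinear q" shows "q 0 = 0"
proof -
  have "q 0 \<le> c * q 0" if "c > 0" for c
    using assms that unfolding sublinear_def by (metis scaleR_zero_right)
  \<comment> \<open>The factor 2 gives \<open>0 \<le> q 0\<close>, the factor 1/2 gives
    \<open>q 0 \<le> 0\<close>.\<close>
  from this[of 2] this[of "1/2"] show ?thesis by simp
qed

lemma sublinear_scaleR:
  assumes q: "sublinear q" and "0 \<le> c" shows "q (c *\<^sub>R x) = c * q x"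
proof (cases "c = 0")
  case True
  then show ?thesis using sublinear_zero[OF q] by simp
next
  case False
  then have c: "c > 0" using assms by simp
  have le: "q (d *\<^sub>R z) \<le> d * q z" if "d > 0" for d z
    using q that by (simp add: sublinear_def)
  have "q (inverse c *\<^sub>R (c *\<^sub>R x)) \<le> inverse c * q (c *\<^sub>R x)"
    using c by (intro le) simp
  then have "c * q x \<le> q (c *\<^sub>R x)" using c by (simp add: field_simps)
  with le[OF c] show ?thesis by (simp add: antisym)
qed

lemma sublinear_minus: "sublinear q \<Longrightarrow> - q (- x) \<le> q x"
  using sublinear_add[of q x "- x"] sublinear_zero[of q] by simp

lemma sublinear_norm: "sublinear (norm :: 'a::real_normed_vector \<Rightarrow> real)"
  by (simp add: sublinear_def norm_triangle_ineq)

text \<open>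
  The value at \<open>t = 1\<close> shows that a functional that is already minimal is superadditive, and,
  at \<open>x = - y\<close>, that every linear functional below the new one takes a value \<open>\<ge> q y\<close> at \<open>y\<close>.
\<close>

lemma sublinear_shift:
  assumes q: "sublinear q"
  obtains r where "sublinear r" "\<And>x. r x \<le> q x" "\<And>x. r x \<le> q (x + y) - q y"
proof
  define h where "h x t = q (x + t *\<^sub>R y) - t * q y" for x t
  define r where "r x = (INF t\<in>{0..}. h x t)" for x
  \<comment> \<open>A bound independent of \<open>t\<close>, so that the infimum defining
    \<open>r\<close> is a genuine one.\<close>
  have low: "- q (- x) \<le> h x t" if "0 \<le> t" for x t
    using sublinear_add[OF q, of "x + t *\<^sub>R y" "- x"] sublinear_scaleR[OF q that, of y]
    by (simp add: h_def)
  then have r_le: "r x \<le> h x t" if "0 \<le> t" for x t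
    unfolding r_def using that by (intro cINF_lower bdd_belowI2[where m = "- q (- x)"]) auto
  have r_ge: "m \<le> r x" if "\<And>t. 0 \<le> t \<Longrightarrow> m \<le> h x t" for m x
    unfolding r_def using that by (intro cINF_greatest) auto
  show "r x \<le> q x" for x using r_le[of 0 x] by (simp add: h_def)
  show "r x \<le> q (x + y) - q y" for x using r_le[of 1 x] by (simp add: h_def)
  show "sublinear r"
  proof (rule sublinearI)
    fix x z
    \<comment> \<open>The parameters add up: \<open>s\<close> for \<open>x\<close> and
      \<open>t\<close> for \<open>z\<close> give \<open>s + t\<close> for \<open>x + z\<close>. The
      infimum is then taken over \<open>t\<close> first and over \<open>s\<close>
      afterwards.\<close>
    have "r (x + z) - h x s \<le> h z t" if "0 \<le> s" "0 \<le> t" for s t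
      using r_le[of "s + t" "x + z"] that sublinear_add[OF q, of "x + s *\<^sub>R y" "z + t *\<^sub>R y"]
      by (simp add: h_def algebra_simps)
    then have "r (x + z) - r z \<le> h x s" if "0 \<le> s" for s
      using r_ge[of "r (x + z) - h x s" z] that by force
    then show "r (x + z) \<le> r x + r z"
      using r_ge[of "r (x + z) - r z" x] by simp
  next
    fix c :: real and x assume c: "c > 0"
    have "r (c *\<^sub>R x) / c \<le> h x t" if "0 \<le> t" for t
    proof -
      have "r (c *\<^sub>R x) \<le> h (c *\<^sub>R x) (c * t)" using c that by (intro r_le) simp
      also have "\<dots> = c * h x t"
        using sublinear_scaleR[OF q, of c "x + t *\<^sub>R y"] c by (simp add: h_def algebra_simps)
      finally show ?thesis using c by (simp add: field_simps)
    qed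
    then show "r (c *\<^sub>R x) \<le> c * r x"
      using r_ge[of "r (c *\<^sub>R x) / c" x] c by (simp add: field_simps)
  qed
qed

text \<open>Supplies the lower bound of a chain for Zorn's lemma. In the proof of subadditivity
  \<open>x\<close> and \<open>y\<close> come with different members \<open>q\<close> and
  \<open>r\<close>; in a chain the smaller one serves for both.\<close>

lemma sublinear_INF_chain:
  assumes "C \<noteq> {}" and sub: "\<And>q. q \<in> C \<Longrightarrow> sublinear q"
    and chain: "\<And>q r. q \<in> C \<Longrightarrow> r \<in> C \<Longrightarrow> q \<le> r \<or> r \<le> q"
    and bdd: "\<And>x. bdd_below ((\<lambda>q. q x) ` C)"
  shows "sublinear (\<lambda>x. INF q\<in>C. q x)"
proof -
  define u where "u = (\<lambda>x. INF q\<in>C. q x)"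
  have u_le: "u x \<le> q x" if "q \<in> C" for x q
    unfolding u_def using that bdd by (intro cINF_lower)
  have u_ge: "m \<le> u x" if "\<And>q. q \<in> C \<Longrightarrow> m \<le> q x" for m x
    unfolding u_def using that assms(1) by (intro cINF_greatest)
  have "sublinear u"
  proof (rule sublinearI)
    fix x y
    have "u (x + y) \<le> q x + r y" if qr: "q \<in> C" "r \<in> C" for q r
    proof -
      obtain p where p: "p \<in> C" "p \<le> q" "p \<le> r" using chain[OF qr] qr by (meson order_refl)
      have "u (x + y) \<le> p x + p y"
        using u_le[OF p(1), of "x + y"] sublinear_add[OF sub[OF p(1)], of x y] by simp
      also have "\<dots> \<le> q x + r y" using p(2,3) by (simp add: le_fun_def add_mono)
      finally show ?thesis .
    qed
    then have "u (x + y) - q x \<le> r y" if "q \<in> C" "r \<in> C" for q r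
      using that by (simp add: algebra_simps)
    then have "u (x + y) - q x \<le> u y" if "q \<in> C" for q
      using that by (intro u_ge)
    then have "u (x + y) - u y \<le> q x" if "q \<in> C" for q
      using that by (simp add: algebra_simps)
    then have "u (x + y) - u y \<le> u x" by (rule u_ge)
    then show "u (x + y) \<le> u x + u y" by simp
  next
    fix c :: real and x assume c: "c > 0"
    have "u (c *\<^sub>R x) / c \<le> q x" if "q \<in> C" for q
      using u_le[OF that, of "c *\<^sub>R x"] sublinear_scaleR[OF sub[OF that], of c x] c
      by (simp add: field_simps)
    then have "u (c *\<^sub>R x) / c \<le> u x" by (rule u_ge)
    then show "u (c *\<^sub>R x) \<le> c * u x" using c by (simp add: field_simps)
  qed
  then show ?thesis by (simp only: u_def)
qed

text \<open>Zorn's lemma gives a minimal sublinear functional below \<open>p\<close>, and minimality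
  makes it additive, hence linear.\<close>

theorem sublinear_dominates_linear:
  fixes p :: "'a::real_vector \<Rightarrow> real"
  assumes p: "sublinear p"
  obtains f where "linear f" "\<And>x. f x \<le> p x"
proof -
  define A where "A = {q. sublinear q \<and> q \<le> p}"
  have "\<exists>m\<in>A. \<forall>a\<in>A. a \<le> m \<longrightarrow> a = m"
  proof (rule predicate_Zorn)
    \<comment> \<open>The order is reversed, so the maximal element of Zorn's lemma is minimal for
      the pointwise order.\<close>
    show "partial_order_on A (relation_of (\<lambda>q r. r \<le> q) A)"
      by (rule partial_order_on_relation_ofI) auto
  next
    fix C assume C: "C \<in> Chains (relation_of (\<lambda>q r. r \<le> q) A)"
    have CA: "C \<subseteq> A" using C by (auto simp: Chains_def relation_of_def)
    have chain: "q \<le> r \<or> r \<le> q" if "q \<in> C" "r \<in> C" for q r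
      using C that by (auto simp: Chains_def relation_of_def)
    show "\<exists>u\<in>A. \<forall>a\<in>C. u \<le> a"
    proof (cases "C = {}")
      case True
      then show ?thesis using p by (auto simp: A_def)
    next
      case False
      define u where "u = (\<lambda>x. INF q\<in>C. q x)"
      \<comment> \<open>Every member \<open>q\<close> satisfies
        \<open>- p (- x) \<le> - q (- x) \<le> q x\<close>.\<close>
      have bdd: "bdd_below ((\<lambda>q. q x) ` C)" for x
      proof (rule bdd_belowI2)
        fix q assume "q \<in> C"
        then have "sublinear q" "q \<le> p" using CA by (auto simp: A_def)
        then show "- p (- x) \<le> q x"
          using sublinear_minus[of q x] le_funD[of q p "- x"] by linarith
      qed
      have "sublinear u"
        unfolding u_def using CA bdd chain False
        by (intro sublinear_INF_chain) (auto simp: A_def)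
      moreover have u_le: "u \<le> q" if "q \<in> C" for q
        unfolding u_def using that bdd by (intro le_funI cINF_lower)
      moreover obtain q where "q \<in> C" using False by blast
      then have "u \<le> p" using u_le[of q] CA by (auto simp: A_def)
      ultimately show ?thesis by (auto simp: A_def)
    qed
  qed
  then obtain m where m: "sublinear m" "m \<le> p"
    and min: "\<And>q. sublinear q \<Longrightarrow> q \<le> m \<Longrightarrow> q = m"
    unfolding A_def by (auto intro: order_trans)
  have add: "m (x + y) = m x + m y" for x y
  proof -
    obtain r where r: "sublinear r" "\<And>x. r x \<le> m x" "\<And>x. r x \<le> m (x + y) - m y"
      using sublinear_shift[OF m(1), of y] by metis
    \<comment> \<open>Minimality turns the third property of \<open>r\<close> into
      \<open>m x + m y \<le> m (x + y)\<close>, the converse of subadditivity.\<close>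
    have "r = m" using r by (intro min) (auto intro: le_funI)
    then show ?thesis using r(3)[of x] sublinear_add[OF m(1), of x y] by simp
  qed
  have neg: "m (- x) = - m x" for x
    using add[of x "- x"] sublinear_zero[OF m(1)] by simp
  have "linear m"
  proof (rule linearI)
    show "m (c *\<^sub>R x) = c *\<^sub>R m x" for c x
    proof (cases "0 \<le> c")
      case True
      then show ?thesis using sublinear_scaleR[OF m(1)] by simp
    next
      case False
      then show ?thesis
        using sublinear_scaleR[OF m(1), of "- c" x] neg[of "c *\<^sub>R x"] by simp
    qed
  qed (rule add)
  then show ?thesis using that m(2) by (auto simp: le_fun_def)
qed

text \<open>The norm is first shifted along \<open>x\<^sub>0\<close>: at \<open>- x\<^sub>0\<close>
  the shifted functional is at most \<open>- norm x\<^sub>0\<close>, so every linear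
  \<open>f\<close> below it has \<open>f x\<^sub>0 \<ge> norm x\<^sub>0\<close>.\<close>

corollary norming_functional:
  fixes x\<^sub>0 :: "'a::real_normed_vector"
  obtains f where "linear f" "\<And>x. \<bar>f x\<bar> \<le> norm x" "f x\<^sub>0 = norm x\<^sub>0"
proof -
  obtain r :: "'a \<Rightarrow> real" where r: "sublinear r" "\<And>x. r x \<le> norm x"
      "\<And>x. r x \<le> norm (x + x\<^sub>0) - norm x\<^sub>0"
    using sublinear_shift[OF sublinear_norm, of x\<^sub>0] by metis
  obtain f where f: "linear f" "\<And>x. f x \<le> r x"
    using sublinear_dominates_linear[OF r(1)] by metis
  have le: "f x \<le> norm x" for x using f(2)[of x] r(2)[of x] by simp
  have neg: "f (- x) = - f x" for x using f(1) by (rule linear_neg)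
  have "\<bar>f x\<bar> \<le> norm x" for x using le[of x] le[of "- x"] neg[of x] by simp
  moreover have "f x\<^sub>0 = norm x\<^sub>0"
    using f(2)[of "- x\<^sub>0"] r(3)[of "- x\<^sub>0"] neg[of "x\<^sub>0"] le[of "x\<^sub>0"] by simp
  ultimately show ?thesis using that f(1) by blast
qed

section \<open>Slices and Daugavet centers\<close>

lemma is_norm_operator_norm_le:
  assumes \<nu>: "is_norm \<nu>" and T: "bounded_operator \<nu> T"
  shows "norm (T x) \<le> operator_norm \<nu> T * \<nu> x"
proof -
  obtain K where K: "\<And>x. norm (T x) \<le> K * \<nu> x"
    using T by (auto simp: bounded_operator_def)
  have nn: "0 \<le> \<nu> x" for x using \<nu> by (simp add: is_norm_def)
  \<comment> \<open>The bound 0 covers the points with \<open>\<nu> x = 0\<close>, where the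
    quotient is 0 by convention.\<close>
  have "norm (T x) / \<nu> x \<le> max K 0" for x
    using K[of x] nn[of x] by (cases "\<nu> x = 0") (auto simp: divide_le_eq le_max_iff_disj)
  then have "norm (T x) / \<nu> x \<le> operator_norm \<nu> T"
    unfolding operator_norm_def by (intro cSUP_upper bdd_aboveI2) auto
  then show ?thesis
    using K[of x] nn[of x] by (cases "\<nu> x = 0") (auto simp: divide_le_eq)
qed

text \<open>The defining equation is applied to the rank-1 operator
  \<open>x \<mapsto> (g * \<phi> x) *\<^sub>R y\<close>, where \<open>g\<close> is the norm of
  \<open>G\<close>. Where the sum nearly attains its norm \<open>2 * g\<close>, both summands must
  be nearly maximal, so \<open>\<phi>\<close> is close to 1 there up to sign.\<close>

lemma daugavet_center_slice:
  fixes G :: "'x::real_vector \<Rightarrow> 'y::banach"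
  assumes \<nu>: "is_norm \<nu>" and G: "daugavet_center \<nu> G"
    and \<phi>: "linear \<phi>" "\<And>x. \<bar>\<phi> x\<bar> \<le> \<nu> x" "\<nu> x\<^sub>0 = 1" "\<phi> x\<^sub>0 = 1"
    and y: "norm y = 1" and e: "0 < e" "e < 1"
  obtains x where "\<nu> x = 1" "\<phi> x > 1 - e"
    "norm (G x + operator_norm \<nu> G *\<^sub>R y) > (2 - e) * operator_norm \<nu> G"
proof -
  define g where "g = operator_norm \<nu> G"
  have nn: "0 \<le> \<nu> x" and z: "\<nu> x = 0 \<longleftrightarrow> x = 0" and hom: "\<nu> (c *\<^sub>R x) = \<bar>c\<bar> * \<nu> x" for x c
    using \<nu> unfolding is_norm_def by blast+
  have bG: "bounded_operator \<nu> G" using G by (simp add: daugavet_center_def)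
  then have lG: "linear G" by (simp add: bounded_operator_def)
  have le: "norm (G x) \<le> g * \<nu> x" for x
    unfolding g_def by (rule is_norm_operator_norm_le[OF \<nu> bG])
  have g: "g > 0"
  proof -
    obtain x where "G x \<noteq> 0" using G by (auto simp: daugavet_center_def)
    then have "0 < g * \<nu> x" using le[of x] by (meson less_le_trans zero_less_norm_iff)
    then show ?thesis using nn[of x] by (simp add: zero_less_mult_iff)
  qed
  define T where "T x = (g * \<phi> x) *\<^sub>R y" for x
  have lT: "linear T"
    unfolding T_def using linear_add[OF \<phi>(1)] linear_scale[OF \<phi>(1)]
    by (intro linearI) (auto simp: algebra_simps)
  have nT: "norm (T x) = g * \<bar>\<phi> x\<bar>" for x using y g by (simp add: T_def abs_mult)
  have Tle: "norm (T x) \<le> g * \<nu> x" for x using \<phi>(2)[of x] g by (simp add: nT)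
  then have bT: "bounded_operator \<nu> T" using lT by (auto simp: bounded_operator_def)
  have "operator_norm \<nu> T = g"
  proof (rule antisym)
    show "operator_norm \<nu> T \<le> g"
      unfolding operator_norm_def using Tle nn z g
      by (intro cSUP_least) (auto simp: divide_le_eq less_le)
    show "g \<le> operator_norm \<nu> T"
      using is_norm_operator_norm_le[OF \<nu> bT, of x\<^sub>0] \<phi>(3,4) g by (simp add: nT)
  qed
  moreover have "dim (range T) = 1"
  proof -
    have "range T = span {y}"
    proof
      show "range T \<subseteq> span {y}" by (auto simp: T_def span_singleton)
      have "k *\<^sub>R y = T ((k / g) *\<^sub>R x\<^sub>0)" for k
        using g \<phi>(4) linear_scale[OF \<phi>(1)] by (simp add: T_def)
      then show "span {y} \<subseteq> range T" by (auto simp: span_singleton)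
    qed
    moreover have "independent {y}" using y by auto
    ultimately show ?thesis using dim_span_eq_card_independent[of "{y}"] by simp
  qed
  ultimately have sup: "operator_norm \<nu> (\<lambda>x. G x + T x) = 2 * g"
    using G bT by (simp add: daugavet_center_def g_def)
  \<comment> \<open>Half of \<open>e\<close> is spent on choosing a point that nearly attains the
    supremum, the other half on replacing \<open>T w\<close> by
    \<open>g *\<^sub>R y\<close>.\<close>
  have lt: "(2 - e / 2) * g < operator_norm \<nu> (\<lambda>x. G x + T x)"
    using e g by (simp add: sup)
  have "\<exists>x. (2 - e / 2) * g < norm (G x + T x) / \<nu> x"
  proof (rule ccontr)
    assume "\<not> ?thesis"
    then have "operator_norm \<nu> (\<lambda>x. G x + T x) \<le> (2 - e / 2) * g"
      unfolding operator_norm_def by (intro cSUP_least) (auto simp: not_less)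
    then show False using lt by simp
  qed
  then obtain x where x: "(2 - e / 2) * g < norm (G x + T x) / \<nu> x" ..
  have "0 < (2 - e / 2) * g" using e g by simp
  then have "\<nu> x \<noteq> 0" using x by (intro notI) simp
  then have \<nu>x: "\<nu> x > 0" using nn[of x] by simp
  \<comment> \<open>Normalises \<open>x\<close> and picks the sign that makes
    \<open>\<phi> w\<close> nonnegative.\<close>
  define c where "c = (if \<phi> x \<ge> 0 then 1 else - 1) / \<nu> x"
  define w where "w = c *\<^sub>R x"
  have abs_c: "\<bar>c\<bar> = 1 / \<nu> x" using \<nu>x by (simp add: c_def)
  have \<nu>w: "\<nu> w = 1" using \<nu>x by (simp add: w_def hom abs_c)
  have "\<phi> w = c * \<phi> x" using linear_scale[OF \<phi>(1), of c x] by (simp add: w_def)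
  also have "\<dots> \<ge> 0" using \<nu>x by (simp add: c_def zero_le_divide_iff)
  finally have \<phi>w: "\<phi> w \<ge> 0" "\<phi> w \<le> 1" using \<phi>(2)[of w] \<nu>w by simp_all
  have "G w + T w = c *\<^sub>R (G x + T x)"
    by (simp add: w_def linear_scale[OF lG] linear_scale[OF lT] algebra_simps)
  then have big: "(2 - e / 2) * g < norm (G w + T w)"
    using x by (simp add: abs_c)
  have "norm (G w + T w) \<le> norm (G w) + norm (T w)" by (rule norm_triangle_ineq)
  also have "\<dots> \<le> g + g * \<phi> w" using le[of w] \<nu>w nT[of w] \<phi>w by simp
  \<comment> \<open>As \<open>G w\<close> contributes at most \<open>g\<close>, the term
    \<open>g * \<phi> w\<close> has to supply the rest.\<close>
  finally have "g * (1 - e / 2) < g * \<phi> w" using big by (simp add: algebra_simps)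
  then have \<phi>w': "1 - e / 2 < \<phi> w" using g by simp
  have GT: "G w + T w = (G w + g *\<^sub>R y) - (g * (1 - \<phi> w)) *\<^sub>R y"
    by (simp add: T_def algebra_simps)
  have "norm (G w + T w) \<le> norm (G w + g *\<^sub>R y) + g * (1 - \<phi> w)"
    unfolding GT using norm_triangle_ineq4[of "G w + g *\<^sub>R y" "(g * (1 - \<phi> w)) *\<^sub>R y"] y \<phi>w g
    by (simp add: abs_mult)
  moreover have "g * (1 - \<phi> w) < g * (e / 2)" using \<phi>w' g by simp
  ultimately have "(2 - e) * g < norm (G w + g *\<^sub>R y)" using big by (simp add: algebra_simps)
  moreover have "1 - e < \<phi> w" using \<phi>w' e by simp
  ultimately show ?thesis using that[of w] \<nu>w by (simp add: g_def)
qed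

section \<open>Two-dimensional lattices\<close>

context
  fixes F :: "real \<times> real \<Rightarrow> real"
  assumes F: "two_dim_lattice F"
begin

lemma lattice_triangle: "F (u + v) \<le> F u + F v"
  and lattice_scaleR: "F (c *\<^sub>R u) = \<bar>c\<bar> * F u"
  and lattice_nonneg: "0 \<le> F u"
  and lattice_eq_0_iff: "F u = 0 \<longleftrightarrow> u = 0"
  using F unfolding two_dim_lattice_def is_norm_def by blast+

lemma lattice_abs: "F (a, b) = F (\<bar>a\<bar>, \<bar>b\<bar>)"
  using F by (simp add: two_dim_lattice_def)

lemma lattice_axes: "F (a, 0) = \<bar>a\<bar>" "F (0, b) = \<bar>b\<bar>"
  using lattice_scaleR[of a "(1, 0)"] lattice_scaleR[of b "(0, 1)"] F
  by (simp_all add: two_dim_lattice_def)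

lemma lattice_ge: "\<bar>a\<bar> \<le> F (a, b)" "\<bar>b\<bar> \<le> F (a, b)"
  using two_dim_lattice_mono[OF F, of "\<bar>a\<bar>" "\<bar>a\<bar>" 0 "\<bar>b\<bar>"]
    two_dim_lattice_mono[OF F, of 0 "\<bar>a\<bar>" "\<bar>b\<bar>" "\<bar>b\<bar>"] lattice_abs[of a b]
  by (simp_all add: lattice_axes)

text \<open>Makes \<open>F\<close> continuous for the Euclidean topology of the plane, in which the
  arc and the limits live. The constant comes from bounding each coordinate by the Euclidean
  norm.\<close>

lemma lattice_lipschitz: "\<bar>F u - F v\<bar> \<le> 2 * dist u v"
proof -
  have F_le: "F w \<le> 2 * norm w" for w
  proof -
    have "F w \<le> \<bar>fst w\<bar> + \<bar>snd w\<bar>"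
      using lattice_triangle[of "(fst w, 0)" "(0, snd w)"] by (simp add: lattice_axes)
    also have "\<dots> \<le> 2 * norm w"
      using norm_fst_le[of "fst w" "snd w"] norm_snd_le[of "snd w" "fst w"] by simp
    finally show ?thesis .
  qed
  have "F u \<le> F (u - v) + F v" "F v \<le> F (v - u) + F u"
    using lattice_triangle[of "u - v" v] lattice_triangle[of "v - u" u] by simp_all
  then show ?thesis
    using F_le[of "u - v"] F_le[of "v - u"] by (simp add: dist_norm norm_minus_commute)
qed

lemma continuous_on_lattice: "continuous_on S F"
proof -
  have "2-lipschitz_on S F"
    by (rule lipschitz_onI) (use lattice_lipschitz in \<open>simp_all add: dist_real_def\<close>)
  then show ?thesis by (rule lipschitz_on_continuous_on)
qed

lemma continuous_on_lattice_comp: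
  "continuous_on S f \<Longrightarrow> continuous_on S (\<lambda>x. F (f x))"
  by (rule continuous_on_compose2[OF continuous_on_lattice[of UNIV]]) auto

lemma tendsto_lattice: "(f \<longlongrightarrow> l) net \<Longrightarrow> ((\<lambda>x. F (f x)) \<longlongrightarrow> F l) net"
  by (rule continuous_on_tendsto_compose[OF continuous_on_lattice[of UNIV]]) auto

text \<open>The arc is the radial projection of the segment from \<open>(1, 0)\<close> to \<open>(0, 1)\<close>.\<close>

lemma positive_sphere_arc:
  obtains g where "arc g" "pathstart g = (1, 0)" "pathfinish g = (0, 1)"
    "path_image g = positive_sphere F"
proof
  define g where "g x = inverse (F (1 - x, x)) *\<^sub>R (1 - x, x)" for x
  have pos: "F (1 - x, x) > 0" for x
    using lattice_nonneg[of "(1 - x, x)"] lattice_eq_0_iff[of "(1 - x, x)"]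
    by (cases "x = 0") (auto simp: less_le zero_prod_def)
  show "arc g"
    unfolding arc_def
  proof
    show "path g"
      unfolding path_def g_def using pos
      by (intro continuous_intros continuous_on_lattice_comp) (auto simp: less_le)
    show "inj_on g {0..1}"
    proof (rule inj_onI)
      fix x y assume "g x = g y"
      then have *: "(1 - x) / F (1 - x, x) = (1 - y) / F (1 - y, y)"
          "x / F (1 - x, x) = y / F (1 - y, y)"
        by (auto simp: g_def divide_inverse mult.commute)
      \<comment> \<open>The coordinates of \<open>(1 - x, x)\<close> sum to 1, so adding the two
        equations isolates the scaling factor.\<close>
      then have "1 / F (1 - x, x) = 1 / F (1 - y, y)"
        by (simp add: diff_divide_distrib)
      then show "x = y" using * pos[of x] pos[of y] by simp
    qed
  qed
  show "pathstart g = (1, 0)" "pathfinish g = (0, 1)"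
    by (simp_all add: g_def pathstart_def pathfinish_def lattice_axes)
  show "path_image g = positive_sphere F"
  proof
    show "path_image g \<subseteq> positive_sphere F"
    proof
      fix u assume "u \<in> path_image g"
      then obtain x where x: "0 \<le> x" "x \<le> 1" "u = g x" by (auto simp: path_image_def)
      have "F u = 1"
        using lattice_scaleR[of "inverse (F (1 - x, x))" "(1 - x, x)"] pos[of x] x by (simp add: g_def)
      then show "u \<in> positive_sphere F"
        using x pos[of x] by (auto simp: positive_sphere_def g_def)
    qed
    show "positive_sphere F \<subseteq> path_image g"
    proof
      fix u assume "u \<in> positive_sphere F"
      then obtain a b where u: "u = (a, b)" "F (a, b) = 1" "0 \<le> a" "0 \<le> b"
        by (auto simp: positive_sphere_def)
      have ab: "a + b > 0"
        using u lattice_axes(1)[of 0] by (cases "a = 0"; cases "b = 0") auto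
      define x where "x = b / (a + b)"
      have e: "(1 - x, x) = inverse (a + b) *\<^sub>R (a, b)"
        using ab by (auto simp: x_def field_simps)
      have "F (1 - x, x) = inverse (a + b)"
        unfolding e lattice_scaleR using ab u by simp
      then have "g x = u"
        unfolding g_def e using ab u by simp
      moreover have "0 \<le> x" "x \<le> 1" using u ab by (auto simp: x_def field_simps)
      ultimately show "u \<in> path_image g" by (auto simp: path_image_def)
    qed
  qed
qed

text \<open>Equality in the triangle inequality for \<open>p\<close> and \<open>q\<close> spreads to
  the cone they span: for \<open>m \<le> l\<close>, completing
  \<open>l *\<^sub>R p + m *\<^sub>R q\<close> to \<open>l *\<^sub>R (p + q)\<close> costs only
  \<open>l - m\<close>, which leaves \<open>2 * l - (l - m) = l + m\<close>.\<close>

lemma lattice_cone_additive: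
  assumes "F p = 1" "F q = 1" "F (p + q) = 2" "0 \<le> l" "0 \<le> m"
  shows "F (l *\<^sub>R p + m *\<^sub>R q) = l + m"
proof (rule antisym)
  show "F (l *\<^sub>R p + m *\<^sub>R q) \<le> l + m"
    using lattice_triangle[of "l *\<^sub>R p" "m *\<^sub>R q"] assms by (simp add: lattice_scaleR)
  show "l + m \<le> F (l *\<^sub>R p + m *\<^sub>R q)"
  proof (cases "m \<le> l")
    case True
    have "l *\<^sub>R (p + q) = (l *\<^sub>R p + m *\<^sub>R q) + (l - m) *\<^sub>R q" by (simp add: algebra_simps)
    then have "F (l *\<^sub>R (p + q)) \<le> F (l *\<^sub>R p + m *\<^sub>R q) + F ((l - m) *\<^sub>R q)"
      using lattice_triangle by metis
    then show ?thesis using True assms by (simp add: lattice_scaleR del: scaleR_add_right)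
  next
    case False
    have "m *\<^sub>R (p + q) = (l *\<^sub>R p + m *\<^sub>R q) + (m - l) *\<^sub>R p" by (simp add: algebra_simps)
    then have "F (m *\<^sub>R (p + q)) \<le> F (l *\<^sub>R p + m *\<^sub>R q) + F ((m - l) *\<^sub>R p)"
      using lattice_triangle by metis
    then show ?thesis using False assms by (simp add: lattice_scaleR del: scaleR_add_right)
  qed
qed

text \<open>The quotient is the linear functional with value 1 at \<open>(1, t)\<close> and
  \<open>(s, 1)\<close>. The rays through these points cut the quadrant into three cones. On the
  outer ones monotonicity reduces \<open>F\<close> to a coordinate, on the middle one
  \<open>F\<close> is additive.\<close>

lemma lattice_eq_max:
  assumes t: "0 \<le> t" "t < 1" and s: "0 \<le> s" "s < 1"
    and eq: "F (1, t) = 1" "F (s, 1) = 1" "F (1 + s, 1 + t) = 2"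
    and ab: "0 \<le> a" "0 \<le> b"
  shows "F (a, b) = max (max a b) (((1 - t) * a + (1 - s) * b) / (1 - s * t))"
proof -
  have st: "s * t < 1" using mult_strict_mono'[of s 1 t 1] s t by simp
  have mono: "F (c, d) \<le> F (c', d')" if "0 \<le> c" "c \<le> c'" "0 \<le> d" "d \<le> d'" for c d c' d'
    using two_dim_lattice_mono[OF F] that by blast
  consider "b \<le> t * a" | "a \<le> s * b" | "t * a \<le> b" "s * b \<le> a" by linarith
  then show ?thesis
  proof cases
    case 1
    have "F (a, b) \<le> F (a *\<^sub>R (1, t))" using 1 ab by (simp add: mono mult.commute)
    also have "\<dots> = a" unfolding lattice_scaleR eq using ab by simp
    finally have "F (a, b) = a" using lattice_ge(1)[of a b] ab by simp
    moreover have "b \<le> a" using 1 t ab mult_right_mono[of t 1 a] by simp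
    moreover have "((1 - t) * a + (1 - s) * b) / (1 - s * t) \<le> a"
      using mult_left_mono[OF 1, of "1 - s"] s st by (simp add: pos_divide_le_eq algebra_simps)
    ultimately show ?thesis by simp
  next
    case 2
    have "F (a, b) \<le> F (b *\<^sub>R (s, 1))" using 2 ab by (simp add: mono mult.commute)
    also have "\<dots> = b" unfolding lattice_scaleR eq using ab by simp
    finally have "F (a, b) = b" using lattice_ge(2)[of b a] ab by simp
    moreover have "a \<le> b" using 2 s ab mult_right_mono[of s 1 b] by simp
    moreover have "((1 - t) * a + (1 - s) * b) / (1 - s * t) \<le> b"
      using mult_left_mono[OF 2, of "1 - t"] t st by (simp add: pos_divide_le_eq algebra_simps)
    ultimately show ?thesis by simp
  next
    case 3
    \<comment> \<open>The coordinates of \<open>(a, b)\<close> in the basis \<open>(1, t)\<close>,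
      \<open>(s, 1)\<close>, by Cramer's rule; they are nonnegative exactly on the middle
      cone.\<close>
    define l m where "l = (a - s * b) / (1 - s * t)" and "m = (b - t * a) / (1 - s * t)"
    have lm: "0 \<le> l" "0 \<le> m" using 3 st by (simp_all add: l_def m_def)
    have ab_eq: "(a, b) = l *\<^sub>R (1, t) + m *\<^sub>R (s, 1)"
    proof -
      have "l + m * s = (a * (1 - s * t)) / (1 - s * t)"
        by (simp add: l_def m_def add_divide_distrib[symmetric] algebra_simps)
      moreover have "l * t + m = (b * (1 - s * t)) / (1 - s * t)"
        by (simp add: l_def m_def add_divide_distrib[symmetric] algebra_simps)
      ultimately show ?thesis using st by simp
    qed
    have "F ((1, t) + (s, 1)) = 2" using eq by (simp add: add.commute)
    then have "F (a, b) = l + m"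
      unfolding ab_eq by (intro lattice_cone_additive eq lm)
    also have "l + m = ((1 - t) * a + (1 - s) * b) / (1 - s * t)"
      by (simp add: l_def m_def add_divide_distrib[symmetric] algebra_simps)
    finally show ?thesis using lattice_ge[of a b] lattice_ge(2)[of b a] ab by simp
  qed
qed

end

section \<open>Hexagonal and octagonal unit balls\<close>

text \<open>A family of pairwise incomparable segments that absorbs every segment in
  \<open>P\<close> consists of the maximal ones.\<close>

lemma edges_eqI:
  assumes "\<And>e. e \<in> S \<Longrightarrow> nondegenerate_segment e \<and> e \<subseteq> P"
    and "\<And>e. nondegenerate_segment e \<Longrightarrow> e \<subseteq> P \<Longrightarrow> \<exists>f\<in>S. e \<subseteq> f"
    and "\<And>e f. e \<in> S \<Longrightarrow> f \<in> S \<Longrightarrow> e \<subseteq> f \<Longrightarrow> e = f"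
  shows "edges P = S"
proof
  show "edges P \<subseteq> S"
  proof
    fix e assume "e \<in> edges P"
    then have e: "nondegenerate_segment e" "e \<subseteq> P"
      and max: "\<And>e'. nondegenerate_segment e' \<Longrightarrow> e' \<subseteq> P \<Longrightarrow> e \<subseteq> e' \<Longrightarrow> e' = e"
      by (auto simp: edges_def)
    obtain f where "f \<in> S" "e \<subseteq> f" using assms(2)[OF e] by blast
    then show "e \<in> S" using max[of f] assms(1)[of f] by simp
  qed
  show "S \<subseteq> edges P"
  proof
    fix e assume e: "e \<in> S"
    have "e' = e" if e': "nondegenerate_segment e'" "e' \<subseteq> P" "e \<subseteq> e'" for e'
    proof -
      obtain f where f: "f \<in> S" "e' \<subseteq> f" using assms(2)[OF e'(1,2)] by blast
      then have "e = f" using assms(3)[OF e, of f] e' by blast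
      then show ?thesis using f e' by blast
    qed
    then show "e \<in> edges P" using assms(1)[OF e] by (auto simp: edges_def)
  qed
qed

lemma nondegenerate_closed_segment_iff: "nondegenerate_segment (closed_segment u v) \<longleftrightarrow> u \<noteq> v"
proof
  assume "nondegenerate_segment (closed_segment u v)"
  then obtain u' v' where *: "u' \<noteq> v'" "closed_segment u v = closed_segment u' v'"
    by (auto simp: nondegenerate_segment_def)
  have "u' \<in> closed_segment u v" "v' \<in> closed_segment u v" unfolding * by simp_all
  then show "u \<noteq> v" using *(1) by auto
qed (unfold nondegenerate_segment_def, blast)

context
  fixes F :: "real \<times> real \<Rightarrow> real" and s t :: real
  assumes F: "two_dim_lattice F"
    and t: "0 \<le> t" "t < 1" and s: "0 \<le> s" "s < 1"
    and eq: "F (1, t) = 1" "F (s, 1) = 1" "F (1 + s, 1 + t) = 2"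
begin

lemma s_times_t_less_1: "s * t < 1"
  using mult_strict_mono'[of s 1 t 1] s t by simp

text \<open>On the quadrant \<open>F\<close> is a maximum of three linear functionals, so the sphere
  is where all are at most 1 and one equals 1. Each face below is the set where a given one equals
  1.\<close>

lemma positive_sphere_iff:
  "(a, b) \<in> positive_sphere F \<longleftrightarrow> 0 \<le> a \<and> a \<le> 1 \<and> 0 \<le> b \<and> b \<le> 1 \<and>
     (1 - t) * a + (1 - s) * b \<le> 1 - s * t \<and>
     (a = 1 \<or> b = 1 \<or> (1 - t) * a + (1 - s) * b = 1 - s * t)"
proof (cases "0 \<le> a \<and> 0 \<le> b")
  case True
  define m where "m = ((1 - t) * a + (1 - s) * b) / (1 - s * t)"
  have "F (a, b) = max (max a b) m"
    using lattice_eq_max[OF F t s eq] True by (simp add: m_def)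
  then have "F (a, b) = 1 \<longleftrightarrow> a \<le> 1 \<and> b \<le> 1 \<and> m \<le> 1 \<and> (a = 1 \<or> b = 1 \<or> m = 1)"
    by linarith
  moreover have "m \<le> 1 \<longleftrightarrow> (1 - t) * a + (1 - s) * b \<le> 1 - s * t"
    "m = 1 \<longleftrightarrow> (1 - t) * a + (1 - s) * b = 1 - s * t"
    using s_times_t_less_1 by (auto simp: m_def)
  ultimately show ?thesis using True by (simp add: positive_sphere_def)
qed (auto simp: positive_sphere_def)

lemma first_face:
  "closed_segment (1, 0) (1, t) = {u \<in> positive_sphere F. fst u = 1}" (is "?S = ?R")
proof
  show "?S \<subseteq> ?R"
  proof
    fix u assume "u \<in> ?S"
    then obtain k where k: "0 \<le> k" "k \<le> 1" "u = (1, k * t)"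
      by (auto simp: closed_segment_def)
    have "k * t \<le> t" using k t by (simp add: mult_left_le_one_le)
    moreover have "(1 - s) * (k * t) \<le> (1 - s) * t"
      using calculation s by (intro mult_left_mono) auto
    ultimately show "u \<in> ?R" using k t by (simp add: positive_sphere_iff algebra_simps)
  qed
  show "?R \<subseteq> ?S"
  proof
    fix u assume u: "u \<in> ?R"
    then obtain b where b: "u = (1, b)" by (cases u) auto
    have "0 \<le> b" "(1 - s) * b \<le> (1 - s) * t"
      using u by (auto simp: b positive_sphere_iff algebra_simps)
    then have "0 \<le> b" "b \<le> t" using s by auto
    \<comment> \<open>For \<open>t = 0\<close> also \<open>b = 0\<close>, and the formula survives
      because \<open>b / t\<close> is then 0.\<close>
    then have "u = (1 - b / t) *\<^sub>R (1, 0) + (b / t) *\<^sub>R (1, t)" "0 \<le> b / t" "b / t \<le> 1"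
      using t by (auto simp: b divide_le_eq_1)
    then show "u \<in> ?S" unfolding closed_segment_def by blast
  qed
qed

lemma last_face:
  "closed_segment (0, 1) (s, 1) = {u \<in> positive_sphere F. snd u = 1}" (is "?S = ?R")
proof
  show "?S \<subseteq> ?R"
  proof
    fix u assume "u \<in> ?S"
    then obtain k where k: "0 \<le> k" "k \<le> 1" "u = (k * s, 1)"
      by (auto simp: closed_segment_def)
    have "k * s \<le> s" using k s by (simp add: mult_left_le_one_le)
    moreover have "(1 - t) * (k * s) \<le> (1 - t) * s"
      using calculation t by (intro mult_left_mono) auto
    ultimately show "u \<in> ?R" using k s by (simp add: positive_sphere_iff algebra_simps)
  qed
  show "?R \<subseteq> ?S"
  proof
    fix u assume u: "u \<in> ?R"
    then obtain a where a: "u = (a, 1)" by (cases u) auto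
    have "0 \<le> a" "(1 - t) * a \<le> (1 - t) * s"
      using u by (auto simp: a positive_sphere_iff algebra_simps)
    then have "0 \<le> a" "a \<le> s" using t by auto
    then have "u = (1 - a / s) *\<^sub>R (0, 1) + (a / s) *\<^sub>R (s, 1)" "0 \<le> a / s" "a / s \<le> 1"
      using s by (auto simp: a divide_le_eq_1)
    then show "u \<in> ?S" unfolding closed_segment_def by blast
  qed
qed

lemma middle_face:
  "closed_segment (1, t) (s, 1) =
     {u \<in> positive_sphere F. (1 - t) * fst u + (1 - s) * snd u = 1 - s * t}" (is "?S = ?R")
proof
  show "?S \<subseteq> ?R"
  proof
    fix u assume "u \<in> ?S"
    then obtain k where k: "0 \<le> k" "k \<le> 1" "u = (1 - k + k * s, (1 - k) * t + k)"
      by (auto simp: closed_segment_def)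
    have "0 \<le> k * s" "0 \<le> (1 - k) * t" "k * s \<le> k" "(1 - k) * t \<le> 1 - k"
      using k s t by (auto simp: mult_left_le)
    then show "u \<in> ?R" using k by (simp add: positive_sphere_iff algebra_simps)
  qed
  show "?R \<subseteq> ?S"
  proof
    fix u assume u: "u \<in> ?R"
    then obtain a b where ab: "u = (a, b)" by (cases u)
    \<comment> \<open>Read off from the first coordinate of
      \<open>(1 - k) *\<^sub>R (1, t) + k *\<^sub>R (s, 1)\<close>; \<open>a \<le> 1\<close> gives
      \<open>0 \<le> k\<close> and \<open>b \<le> 1\<close> gives \<open>k \<le> 1\<close>.\<close>
    define k where "k = (1 - a) / (1 - s)"
    have le: "a \<le> 1" "b \<le> 1" and e: "(1 - t) * a + (1 - s) * b = 1 - s * t"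
      using u by (auto simp: ab positive_sphere_iff)
    have a: "a = 1 - k * (1 - s)" using s by (simp add: k_def)
    have "(1 - s) * b = (1 - s) * (t + k * (1 - t))"
      using e unfolding a by (simp add: algebra_simps)
    then have b: "b = t + k * (1 - t)" using s by simp
    have "0 \<le> k" using le s by (simp add: k_def)
    moreover have "k * (1 - t) \<le> 1 * (1 - t)" using le b by simp
    then have "k \<le> 1" using t by simp
    moreover have "u = (1 - k) *\<^sub>R (1, t) + k *\<^sub>R (s, 1)"
      by (simp add: ab a b algebra_simps)
    ultimately show "u \<in> ?S" unfolding closed_segment_def by blast
  qed
qed

text \<open>
  A functional bounded by \<open>1\<close> on the sphere that takes the value \<open>1\<close> at the midpoint takes it at
  both ends.
\<close>

lemma segment_in_face:
  assumes "closed_segment u v \<subseteq> positive_sphere F"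
  shows "{u, v} \<subseteq> closed_segment (1, 0) (1, t) \<or> {u, v} \<subseteq> closed_segment (0, 1) (s, 1) \<or>
    {u, v} \<subseteq> closed_segment (1, t) (s, 1)"
proof -
  obtain a b c d where uv: "u = (a, b)" "v = (c, d)" by fastforce
  have "midpoint u v = ((a + c) / 2, (b + d) / 2)"
    by (simp add: uv midpoint_def)
  then have m: "((a + c) / 2, (b + d) / 2) \<in> positive_sphere F"
    using assms midpoint_in_closed_segment[of u v] by auto
  have u: "(a, b) \<in> positive_sphere F" and v: "(c, d) \<in> positive_sphere F"
    using assms uv by auto
  consider "a + c = 2" | "b + d = 2" | "(1 - t) * (a + c) + (1 - s) * (b + d) = 2 * (1 - s * t)"
    using m by (auto simp: positive_sphere_iff field_simps)
  then show ?thesis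
  proof cases
    case 1
    then have "a = 1" "c = 1" using u v by (auto simp: positive_sphere_iff)
    then show ?thesis using u v by (simp add: uv first_face)
  next
    case 2
    then have "b = 1" "d = 1" using u v by (auto simp: positive_sphere_iff)
    then show ?thesis using u v by (simp add: uv last_face)
  next
    case 3
    then have "(1 - t) * a + (1 - s) * b = 1 - s * t" "(1 - t) * c + (1 - s) * d = 1 - s * t"
      using u v by (auto simp: positive_sphere_iff algebra_simps)
    then show ?thesis using u v by (simp add: uv middle_face)
  qed
qed

text \<open>Every segment in the sphere lies in one of the three faces, and suitable endpoints
  separate the nondegenerate faces. The vertical face is a single point if \<open>t = 0\<close>, the
  horizontal one if \<open>s = 0\<close>.\<close>

lemma edges_positive_sphere:
  "edges (positive_sphere F) = {closed_segment (1, t) (s, 1)} \<union>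
     (if t = 0 then {} else {closed_segment (1, 0) (1, t)}) \<union>
     (if s = 0 then {} else {closed_segment (0, 1) (s, 1)})"
    and card_edges_positive_sphere:
  "card (edges (positive_sphere F)) = 1 + of_bool (t \<noteq> 0) + of_bool (s \<noteq> 0)"
proof -
  define A where "A = closed_segment (1 :: real, 0) (1, t)"
  define B where "B = closed_segment (1, t) (s, 1)"
  define C where "C = closed_segment (0, 1 :: real) (s, 1)"
  note defs = A_def B_def C_def
  have mem: "(1, 0) \<in> A" "(1, t) \<in> B" "(s, 1) \<in> B" "(0, 1) \<in> C"
    by (simp_all add: defs)
  have "(s, 1) \<notin> A" "(0, 1) \<notin> A" "(1, t) \<notin> C" "(1, 0) \<notin> C"
    unfolding defs first_face last_face using s t by simp_all
  then have BA: "\<not> B \<subseteq> A" "\<not> B \<subseteq> C" "\<not> A \<subseteq> C" "\<not> C \<subseteq> A"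
    using mem by blast+
  \<comment> \<open>For \<open>t = 0\<close> this fails: \<open>A\<close> is then the point
    \<open>(1, 0)\<close>, an end of \<open>B\<close>.\<close>
  have AB: "\<not> A \<subseteq> B" if "t \<noteq> 0"
  proof -
    have "(1, 0) \<notin> B"
      unfolding defs middle_face using that s by (auto simp: algebra_simps)
    then show ?thesis using mem by blast
  qed
  have CB: "\<not> C \<subseteq> B" if "s \<noteq> 0"
  proof -
    have "(0, 1) \<notin> B"
      unfolding defs middle_face using that t by (auto simp: algebra_simps)
    then show ?thesis using mem by blast
  qed
  have nondegenerate: "nondegenerate_segment A \<longleftrightarrow> t \<noteq> 0" "nondegenerate_segment B"
      "nondegenerate_segment C \<longleftrightarrow> s \<noteq> 0"
    unfolding defs nondegenerate_closed_segment_iff using s by auto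
  have sub: "A \<subseteq> positive_sphere F" "B \<subseteq> positive_sphere F" "C \<subseteq> positive_sphere F"
    unfolding defs first_face middle_face last_face by auto
  let ?S = "{e \<in> {A, B, C}. nondegenerate_segment e}"
  have "edges (positive_sphere F) = ?S"
  proof (rule edges_eqI)
    show "nondegenerate_segment e \<and> e \<subseteq> positive_sphere F" if "e \<in> ?S" for e
      using that sub by blast
  next
    fix e assume e: "nondegenerate_segment e" "e \<subseteq> positive_sphere F"
    then obtain u v where uv: "u \<noteq> v" "e = closed_segment u v"
      by (auto simp: nondegenerate_segment_def)
    have "{u, v} \<subseteq> A \<or> {u, v} \<subseteq> C \<or> {u, v} \<subseteq> B"
      unfolding defs by (rule segment_in_face) (use e(2) uv(2) in blast)
    then obtain f where f: "f \<in> {A, B, C}" "{u, v} \<subseteq> f" by blast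
    then obtain p q where pq: "f = closed_segment p q" by (auto simp: defs)
    have "p \<noteq> q" using uv(1) f(2) pq by auto
    then have "f \<in> ?S" using f(1) by (simp add: pq nondegenerate_closed_segment_iff)
    moreover have "e \<subseteq> f"
      unfolding uv pq using f(2) pq by (intro closed_segment_subset) auto
    ultimately show "\<exists>f\<in>?S. e \<subseteq> f" ..
  next
    fix e f assume "e \<in> ?S" "f \<in> ?S" "e \<subseteq> f"
    then show "e = f" using AB CB BA nondegenerate by blast
  qed
  also have "?S = {B} \<union> (if t = 0 then {} else {A}) \<union> (if s = 0 then {} else {C})"
    using nondegenerate by auto
  finally have edges: "edges (positive_sphere F) =
    {B} \<union> (if t = 0 then {} else {A}) \<union> (if s = 0 then {} else {C})" .
  then show "edges (positive_sphere F) = {closed_segment (1, t) (s, 1)} \<union>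
     (if t = 0 then {} else {closed_segment (1, 0) (1, t)}) \<union>
     (if s = 0 then {} else {closed_segment (0, 1) (s, 1)})"
    by (simp only: defs)
  have "A \<noteq> B" if "t \<noteq> 0" using AB[OF that] by blast
  moreover have "C \<noteq> B" if "s \<noteq> 0" using CB[OF that] by blast
  moreover have "A \<noteq> C" using BA by blast
  ultimately show "card (edges (positive_sphere F)) = 1 + of_bool (t \<noteq> 0) + of_bool (s \<noteq> 0)"
    unfolding edges by (auto simp: card_insert_if)
qed

lemma polygon_with_edges_F: "polygon_with_edges F (1 + of_bool (t \<noteq> 0) + of_bool (s \<noteq> 0))"
proof -
  have "positive_sphere F = \<Union> (edges (positive_sphere F))"
  proof
    show "\<Union> (edges (positive_sphere F)) \<subseteq> positive_sphere F" by (auto simp: edges_def)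
    show "positive_sphere F \<subseteq> \<Union> (edges (positive_sphere F))"
    proof
      fix u assume u: "u \<in> positive_sphere F"
      \<comment> \<open>A degenerate face is no edge, but its only point is an end of the middle
        edge and thus still covered.\<close>
      have "(1, t) \<in> closed_segment (1, t) (s, 1)" "(s, 1) \<in> closed_segment (1, t) (s, 1)" by simp_all
      moreover have "u \<in> closed_segment (1, 0) (1, t) \<or> u \<in> closed_segment (0, 1) (s, 1) \<or>
          u \<in> closed_segment (1, t) (s, 1)"
        \<comment> \<open>A single point is located by means of the degenerate segment from
          \<open>u\<close> to itself.\<close>
        using segment_in_face[of u u] u by simp
      ultimately show "u \<in> \<Union> (edges (positive_sphere F))"
        by (auto simp: edges_positive_sphere)
    qed
  qed
  moreover have "finite (edges (positive_sphere F))" by (simp add: edges_positive_sphere)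
  moreover have "\<exists>g. arc g \<and> pathstart g = (1, 0) \<and> pathfinish g = (0, 1) \<and>
      path_image g = positive_sphere F"
    using positive_sphere_arc[OF F] by metis
  ultimately show ?thesis
    by (simp add: polygon_with_edges_def polygonal_arc_with_edges_def card_edges_positive_sphere)
qed

lemma x_hat1_eq: "x_hat1 F = t"
  unfolding x_hat1_def
proof (rule Greatest_equality)
  show "(1, t) \<in> positive_sphere F" using eq t by (simp add: positive_sphere_def)
  show "y \<le> t" if "(1, y) \<in> positive_sphere F" for y
  proof -
    have "(1 - s) * y \<le> (1 - s) * t" using that by (simp add: positive_sphere_iff algebra_simps)
    then show ?thesis using s by simp
  qed
qed

lemma x_hat2_eq: "x_hat2 F = s"
  unfolding x_hat2_def
proof (rule Greatest_equality)
  show "(s, 1) \<in> positive_sphere F" using eq s by (simp add: positive_sphere_def)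
  show "x \<le> s" if "(x, 1) \<in> positive_sphere F" for x
  proof -
    have "(1 - t) * x \<le> (1 - t) * s" using that by (simp add: positive_sphere_iff algebra_simps)
    then show ?thesis using t by simp
  qed
qed

text \<open>With \<open>t\<close> and \<open>s\<close> as the two maxima, the number of zeros among
  them decides: two give \<open>ell1_2\<close>, one gives two edges and \<open>calF 2 2\<close>,
  none gives three edges and \<open>calF 2 3\<close>.\<close>

lemma hexagonal_octagonal_in_frakM2: "F \<in> frakM2"
proof (cases "s = 0 \<and> t = 0")
  case True
  have "F (a, b) = \<bar>a\<bar> + \<bar>b\<bar>" for a b
    using lattice_abs[OF F, of a b] lattice_eq_max[OF F t s eq, of "\<bar>a\<bar>" "\<bar>b\<bar>"] True by simp
  then have "F = ell1_2" by (auto simp: ell1_2_def fun_eq_iff)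
  then show ?thesis by (simp add: frakM2_def)
next
  case False
  then have "F \<in> calF 2 2 \<or> F \<in> calF 2 3"
    using polygon_with_edges_F F s t
    by (cases "s = 0"; cases "t = 0") (auto simp: calF_def x_hat1_eq x_hat2_eq numeral_2_eq_2 numeral_3_eq_3)
  then show ?thesis by (auto simp: frakM2_def)
qed

end

lemma frakM2I:
  assumes F: "two_dim_lattice F"
    and ts: "0 \<le> t" "0 \<le> s"
    and eq: "F (1, t) = 1" "F (s, 1) = 1" "F (1 + s, 1 + t) = 2"
  shows "F \<in> frakM2"
proof -
  have le: "t \<le> 1" "s \<le> 1" using lattice_ge(2)[OF F, of t 1] lattice_ge(1)[OF F, of s 1] eq by simp_all
  show ?thesis
  proof (cases "t = 1 \<or> s = 1")
    case True
    \<comment> \<open>Either equality puts the corner \<open>(1, 1)\<close> on the sphere, and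
      monotonicity then forces the maximum norm.\<close>
    then have 11: "F (1, 1) = 1" using eq by auto
    have "F (a, b) = max \<bar>a\<bar> \<bar>b\<bar>" for a b
    proof (rule antisym)
      have "F (a, b) \<le> F (max \<bar>a\<bar> \<bar>b\<bar> *\<^sub>R (1, 1))"
        using lattice_abs[OF F, of a b] by (simp add: two_dim_lattice_mono[OF F])
      then show "F (a, b) \<le> max \<bar>a\<bar> \<bar>b\<bar>"
        unfolding lattice_scaleR[OF F] 11 by simp
      show "max \<bar>a\<bar> \<bar>b\<bar> \<le> F (a, b)"
        using lattice_ge(1)[OF F, of a b] lattice_ge(2)[OF F, of b a] by simp
    qed
    then have "F = ell_infinity_2" by (auto simp: ell_infinity_2_def fun_eq_iff)
    then show ?thesis by (simp add: frakM2_def)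
  next
    case False
    then show ?thesis using hexagonal_octagonal_in_frakM2[OF F] ts le eq by simp
  qed
qed

section \<open>Almost extremal points in the sum, and passage to the limit\<close>

lemma daugavet_domain_F_sum_points:
  fixes F :: "real \<times> real \<Rightarrow> real"
  assumes F: "two_dim_lattice F"
    and "(UNIV :: 'a::banach set) \<noteq> {0}" "(UNIV :: 'b::banach set) \<noteq> {0}"
    and dom: "daugavet_domain (F_sum_norm F :: 'a \<times> 'b \<Rightarrow> real) TYPE('y::banach)"
    and e: "0 < e" "e < 1"
  obtains a b c d where "F (a, b) = 1" "F (c, d) = 1" "1 - e < a" "a \<le> 1" "1 - e < d" "d \<le> 1"
    "0 \<le> b" "b \<le> 1" "0 \<le> c" "c \<le> 1" "2 - 2 * e < F (a + c, b + d)"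
proof -
  let ?n = "F_sum_norm F :: 'a \<times> 'b \<Rightarrow> real"
  obtain G :: "'a \<times> 'b \<Rightarrow> 'y" where G: "daugavet_center ?n G" and \<nu>: "is_norm ?n"
    using dom by (auto simp: daugavet_domain_def banach_norm_def)
  obtain a0 :: 'a where a0: "a0 \<noteq> 0" using assms(2) by auto
  obtain b0 :: 'b where b0: "b0 \<noteq> 0" using assms(3) by auto
  obtain f where f: "linear f" "\<And>x. \<bar>f x\<bar> \<le> norm x" "f (sgn a0) = norm (sgn a0)"
    using norming_functional[of "sgn a0"] by metis
  obtain h where h: "linear h" "\<And>x. \<bar>h x\<bar> \<le> norm x" "h (sgn b0) = norm (sgn b0)"
    using norming_functional[of "sgn b0"] by metis
  obtain w where w: "G w \<noteq> 0" using G by (auto simp: daugavet_center_def)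
  define g where "g = operator_norm ?n G"
  have bG: "bounded_operator ?n G" using G by (simp add: daugavet_center_def)
  then have lG: "linear G" by (simp add: bounded_operator_def)
  have Gle: "norm (G x) \<le> g * ?n x" for x
    unfolding g_def by (rule is_norm_operator_norm_le[OF \<nu> bG])
  have nle: "norm (fst x) \<le> ?n x" "norm (snd x) \<le> ?n x" for x
    using F_sum_norm_bounds(1)[OF F, of "fst x" "snd x"]
      F_sum_norm_bounds(2)[OF F, of "snd x" "fst x"] by simp_all
  have g: "g > 0"
  proof -
    have "0 < g * ?n w" using Gle[of w] w by (meson less_le_trans zero_less_norm_iff)
    moreover have "0 \<le> ?n w" using nle(1)[of w] norm_ge_zero order_trans by blast
    ultimately show ?thesis by (simp add: zero_less_mult_iff)
  qed
  \<comment> \<open>The direction \<open>sgn (G w)\<close> is an arbitrary unit vector; it serves to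
    make \<open>norm (G u)\<close> almost \<open>g\<close>.\<close>
  obtain u where u: "?n u = 1" "1 - e < (f \<circ> fst) u" "norm (G u + g *\<^sub>R sgn (G w)) > (2 - e) * g"
  proof (rule daugavet_center_slice[OF \<nu> G, of "f \<circ> fst" "(sgn a0, 0)" "sgn (G w)" e])
    show "linear (f \<circ> fst)" by (intro linear_compose f linear_fst)
    show "\<bar>(f \<circ> fst) x\<bar> \<le> ?n x" for x
      using f(2)[of "fst x"] nle(1)[of x] by simp
  qed (use a0 w e f in \<open>simp_all add: F_sum_norm_def norm_sgn lattice_axes[OF F] g_def\<close>)
  have "norm (G u + g *\<^sub>R sgn (G w)) \<le> norm (G u) + g"
    using norm_triangle_ineq[of "G u" "g *\<^sub>R sgn (G w)"] w g by (simp add: norm_sgn)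
  then have Gu: "(1 - e) * g < norm (G u)" using u(3) by (simp add: algebra_simps)
  have "0 < (1 - e) * g" using e g by simp
  then have "G u \<noteq> 0" using Gu by auto
  obtain v where v: "?n v = 1" "1 - e < (h \<circ> snd) v" "norm (G v + g *\<^sub>R sgn (G u)) > (2 - e) * g"
  proof (rule daugavet_center_slice[OF \<nu> G, of "h \<circ> snd" "(0, sgn b0)" "sgn (G u)" e])
    show "linear (h \<circ> snd)" by (intro linear_compose h linear_snd)
    show "\<bar>(h \<circ> snd) x\<bar> \<le> ?n x" for x
      using h(2)[of "snd x"] nle(2)[of x] by simp
  qed (use b0 \<open>G u \<noteq> 0\<close> e h in \<open>simp_all add: F_sum_norm_def norm_sgn lattice_axes[OF F] g_def\<close>)
  \<comment> \<open>Replacing \<open>g *\<^sub>R sgn (G u)\<close> by \<open>G u\<close> costs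
    \<open>g - norm (G u) < e * g\<close>. With the loss \<open>e * g\<close> from the second slice,
    \<open>norm (G (u + v))\<close> exceeds \<open>(2 - 2 * e) * g\<close>.\<close>
  have "g *\<^sub>R sgn (G u) - G u = (g - norm (G u)) *\<^sub>R sgn (G u)"
    using \<open>G u \<noteq> 0\<close> by (simp add: sgn_div_norm algebra_simps)
  then have "norm (g *\<^sub>R sgn (G u) - G u) = g - norm (G u)"
    using \<open>G u \<noteq> 0\<close> Gle[of u] u(1) by (simp add: norm_sgn)
  then have "norm (G v + g *\<^sub>R sgn (G u)) \<le> norm (G (u + v)) + (g - norm (G u))"
    using norm_triangle_ineq[of "G (u + v)" "g *\<^sub>R sgn (G u) - G u"]
    by (simp add: linear_add[OF lG] algebra_simps)
  then have "(2 - 2 * e) * g < norm (G (u + v))" using v(3) Gu by (simp add: algebra_simps)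
  also have "\<dots> \<le> ?n (u + v) * g" using Gle[of "u + v"] by (simp add: mult.commute)
  finally have "2 - 2 * e < ?n (u + v)" using g by simp
  also have "\<dots> \<le> F (norm (fst u) + norm (fst v), norm (snd u) + norm (snd v))"
    by (auto simp: F_sum_norm_def split_beta intro!: two_dim_lattice_mono[OF F] norm_triangle_ineq)
  finally show ?thesis
    using u(1,2) v(1,2) f(2)[of "fst u"] h(2)[of "snd v"] nle[of u] nle[of v]
    by (intro that[of "norm (fst u)" "norm (snd u)" "norm (fst v)" "norm (snd v)"])
      (auto simp: F_sum_norm_def split_beta)
qed

theorem corollary5p2:
  fixes F :: "real \<times> real \<Rightarrow> real"
  assumes "two_dim_lattice F"
    and "F \<notin> frakM2"
    and "(UNIV :: 'a::banach set) \<noteq> {0}"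
    and "(UNIV :: 'b::banach set) \<noteq> {0}"
  shows "\<not> daugavet_domain (F_sum_norm F :: 'a \<times> 'b \<Rightarrow> real) TYPE('y::banach)"
proof
  assume dom: "daugavet_domain (F_sum_norm F :: 'a \<times> 'b \<Rightarrow> real) TYPE('y)"
  note F = assms(1)
  \<comment> \<open>The shift by 2 keeps \<open>e n\<close> below 1 even at
    \<open>n = 0\<close>.\<close>
  define e where "e n = inverse (real (n + 2))" for n
  have e: "0 < e n" "e n < 1" for n by (auto simp: e_def field_simps)
  have e0: "e \<longlonglongrightarrow> 0"
    unfolding e_def using LIMSEQ_ignore_initial_segment[OF LIMSEQ_inverse_real_of_nat, of 1] by simp
  have "\<exists>a b c d. F (a, b) = 1 \<and> F (c, d) = 1 \<and> 1 - e n < a \<and> a \<le> 1 \<and> 1 - e n < d \<and> d \<le> 1 \<and>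
      0 \<le> b \<and> b \<le> 1 \<and> 0 \<le> c \<and> c \<le> 1 \<and> 2 - 2 * e n < F (a + c, b + d)" for n
    using daugavet_domain_F_sum_points[OF F assms(3,4) dom e, of n] by metis
  then obtain a b c d where F1: "\<And>n. F (a n, b n) = 1" "\<And>n. F (c n, d n) = 1"
    and a: "\<And>n. 1 - e n < a n" "\<And>n. a n \<le> 1" and d: "\<And>n. 1 - e n < d n" "\<And>n. d n \<le> 1"
    and bc: "\<And>n. 0 \<le> b n" "\<And>n. b n \<le> 1" "\<And>n. 0 \<le> c n" "\<And>n. c n \<le> 1"
    and F2: "\<And>n. 2 - 2 * e n < F (a n + c n, b n + d n)"
    by metis
  \<comment> \<open>A subsequence is needed only for \<open>b\<close> and \<open>c\<close>;
    \<open>a\<close> and \<open>d\<close> are squeezed to 1.\<close>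
  have "compact ({0..1} \<times> {0..1} :: (real \<times> real) set)" by (intro compact_Times compact_Icc)
  then have "\<exists>l\<in>{0..1} \<times> {0..1}. \<exists>r. strict_mono r \<and> ((\<lambda>n. (b n, c n)) \<circ> r) \<longlonglongrightarrow> l"
    unfolding compact_def using bc by (elim allE[of _ "\<lambda>n. (b n, c n)"]) simp
  then obtain l r where lr: "l \<in> {0..1} \<times> {0..1}" "strict_mono r"
      "((\<lambda>n. (b n, c n)) \<circ> r) \<longlonglongrightarrow> l"
    by blast
  obtain t s where l: "l = (t, s)" by fastforce
  have er: "(\<lambda>n. e (r n)) \<longlonglongrightarrow> 0"
    using LIMSEQ_subseq_LIMSEQ[OF e0 lr(2)] by (simp add: o_def)
  have bt: "(\<lambda>n. b (r n)) \<longlonglongrightarrow> t" and cs: "(\<lambda>n. c (r n)) \<longlonglongrightarrow> s"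
    using tendsto_fst[OF lr(3)] tendsto_snd[OF lr(3)] by (simp_all add: o_def l)
  have lim1: "(\<lambda>n. 1 - e (r n)) \<longlonglongrightarrow> 1" using tendsto_diff[OF tendsto_const er, of 1] by simp
  have squeeze: "(\<lambda>n. x (r n)) \<longlonglongrightarrow> 1" if "\<And>n. 1 - e n < x n" "\<And>n. x n \<le> 1" for x
    by (rule tendsto_sandwich[OF _ _ lim1 tendsto_const]) (auto intro!: always_eventually intro: less_imp_le that)
  note a1 = squeeze[OF a] and d1 = squeeze[OF d]
  note lims = tendsto_lattice[OF F] tendsto_Pair tendsto_add a1 d1 bt cs
  have "(\<lambda>n. F (a (r n), b (r n))) \<longlonglongrightarrow> F (1, t)" "(\<lambda>n. F (c (r n), d (r n))) \<longlonglongrightarrow> F (s, 1)"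
    by (intro lims)+
  then have eq: "F (1, t) = 1" "F (s, 1) = 1" by (simp_all add: F1 LIMSEQ_const_iff)
  \<comment> \<open>The almost-equality in the triangle inequality becomes an equality at the limit
    points \<open>(1, t)\<close> and \<open>(s, 1)\<close>.\<close>
  have "2 \<le> F (1 + s, t + 1)"
  proof (rule LIMSEQ_le)
    show "(\<lambda>n. F (a (r n) + c (r n), b (r n) + d (r n))) \<longlonglongrightarrow> F (1 + s, t + 1)" by (intro lims)
    show "(\<lambda>n. 2 - 2 * e (r n)) \<longlonglongrightarrow> 2"
      using tendsto_diff[OF tendsto_const tendsto_mult_left[OF er], of 2 2] by simp
    show "\<exists>N. \<forall>n\<ge>N. 2 - 2 * e (r n) \<le> F (a (r n) + c (r n), b (r n) + d (r n))"
      using F2 less_imp_le by blast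
  qed
  moreover have "F (1 + s, t + 1) \<le> 2"
    using lattice_triangle[OF F, of "(1, t)" "(s, 1)"] eq by simp
  ultimately have "F \<in> frakM2"
    using frakM2I[OF F, of t s] eq lr(1) by (simp add: l add.commute)
  then show False using assms(2) by simp
qed

end
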